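(* In the setting of the context, let $\mathcal D=\{V=G\}$, $\mathcal C=\{V>G\}$, $\tau_{\mathcal D}=\inf\{t\ge0:X_t\in\mathcal D\}$. Assume: (i) $V$ is continuous, for every $x_1\ge0$ the map $x_2\mapsto V(x_1,x_2)-G(x_1,x_2)$ is nonincreasing and vanishes for some $x_2\ge 0$, so that $\mathcal D=\{(x_1,x_2)\in\mathbb R^2_+:x_2\ge b(x_1)\}$ with $b(x_1)=\inf\{x_2\ge0:(x_1,x_2)\in\mathcal D\}$; (ii) $b\in C((0,\infty))\cap W^{1,\infty}_{\mathrm{loc}}((0,\infty))$ and $\inf_{I}b>0$ for every compact interval $I\subset(0,\infty)$; (iii) $\tau_{\mathcal D}$ is optimal for $V(x)$ for every $x$, and the generalized Itô–Tanaka identity $$e^{-rt}G(X_t)=G(x)+\int_0^te^{-rs}c(X_s)ds-\int_0^te^{-rs}dA^\Gamma_s+M_t\qquad(M\text{ a local martingale})$$ may be applied up to $\tau_{\mathcal D}$ with the required localization and uniform integrability: for each $x$ there are bounded stopping times $\sigma_k\uparrow\tau_{\mathcal D}$ along which the identity holds with $\mathbb E_x[M_{\sigma_k}]=0$, and, as $k\to\infty$, the expectations of $e^{-r\sigma_k}G(X_{\sigma_k})$, $\int_0^{\sigma_k}e^{-rs}c(X_s)ds$ and $\int_0^{\sigma_k}e^{-rs}dA^\Gamma_s$ are finite and converge to the corresponding finite expectations with $\sigma_k$ replaced by $\tau_{\mathcal D}$. Write $z_b(x_1)=(x_1,b(x_1))$. Then, for every boundary point $z_b(x_1)$ at which the continuation-side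 trace is well defined (in particular $z_b(x_1)\in\overline{\mathcal C}$), $$\lim_{\substack{x\to z_b(x_1)\\ x\in\mathcal C}}R^{\mathcal C}_r\Gamma(x)=0 .$$ If non-tangential traces are used, the same holds with the limit taken over $x\in\mathcal C$ tending to $z_b(x_1)$ non-tangentially.
   Context: Setting. $\mathbb R^2_+=[0,\infty)^2$, discount rate $r>0$, $\alpha>0$, $W$ a two-dimensional Brownian motion on a filtered probability space satisfying the usual conditions. For $x\in\mathbb R^2_+$, $X=X^x$ solves the normally reflected SDE $X_t=x+\int_0^t\mu(X_s)ds+\int_0^t\sigma(X_s)dW_s+L_t$ in $\mathbb R^2_+$, where $L=(L^1,L^2)$, each $L^i$ is continuous, nondecreasing, $L^i_0=0$, and $\int_0^\infty\mathbf 1_{\{X^i_t>0\}}dL^i_t=0$. Put $a=\sigma\sigma^\top$. Standing assumptions: (A1) $\mu,\sigma$ are locally Lipschitz with at most linear growth. (A2) For every compact $K\subset\mathbb R^2_+$ there is $\lambda_K>0$ with $\xi^\top a(x)\xi\ge\lambda_K|\xi|^2$ for $x\in K$, $\xi\in\mathbb R^2$. (A3) The reflected SDE has a unique strong solution for each $x$ and the family is strong Markov. (A4) For every $T>0$, every compact $K\subset\mathbb R^2_+$ and some $q\ge1$, $\lim_{y\to x}\mathbb E[\sup_{t\le T}|X^y_t-X^x_t|^q]=0$ for $x\in K$. (A5) $G(x_1,x_2)=x_1\vee\alpha x_2$, and $c:\mathbb R^2_+\to[0,\infty)$ is continuous. (A6) $V$ below satisfies $0\le V(x)\le C_V(1+|x|^p)$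 for some $C_V>0,p\ge1$, and the payoff terms are integrable for all stopping times considered. Value function: $V(x)=\sup_\tau\mathbb E_x[e^{-r\tau}G(X_\tau)-\int_0^\tau e^{-rs}c(X_s)ds]$ over all $[0,\infty]$-valued stopping times, with $e^{-r\tau}G(X_\tau):=0$ on $\{\tau=\infty\}$; $\tau$ is optimal for $V(x)$ if it attains the supremum. Stopping-gain measure: $\Delta=\{x_1=\alpha x_2\}$ with surface measure $\sigma_\Delta$; $q(x)=a_{11}-2\alpha a_{12}+\alpha^2a_{22}$; $\Gamma=\Gamma^{\mathrm{ac}}dx+\Gamma^\Delta$, where $\Gamma^{\mathrm{ac}}=c+rx_1-\mu_1$ on $\{x_1>\alpha x_2\}$, $\Gamma^{\mathrm{ac}}=c+r\alpha x_2-\alpha\mu_2$ on $\{x_1<\alpha x_2\}$, and $\Gamma^\Delta(dx)=-\frac{q(x)}{2\sqrt{1+\alpha^2}}\sigma_\Delta(dx)$. The associated signed continuous additive functional is $A^\Gamma_t=\int_0^t\Gamma^{\mathrm{ac}}(X_s)\mathbf 1_{\{X_s\notin\Delta\}}ds-\frac12L^0_t(Y)$, with $L^0(Y)$ the symmetric local time at $0$ of $Y=X^1-\alpha X^2$. It is a standing assumption that the reflection terms do not contribute to the Itô–Tanaka formula for $G(X)$ at the corner $(0,0)$. Killed resolvent: $R^{\mathcal C}_r\nu(x):=\mathbb E_x[\int_0^{\tau_{\mathcal D}}e^{-rs}dA^\nu_s]$ for a signed smooth measure $\nu$ with additive functional $A^\nu$; it is assumed that $R^{\mathcal C}_r\Gamma^+(x)+R^{\mathcal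 C}_r\Gamma^-(x)<\infty$ for all $x$, where $\Gamma^\pm$ are the positive and negative parts of $\Gamma$. *)

theory Defs
  imports "HOL-Probability.Probability"
begin

section \<open>Function spaces\<close>

definition quadrant :: "(real^2) set" where
  "quadrant = {x. \<forall>i. 0 \<le> x $ i}"

definition locally_lipschitz_on :: "'a::metric_space set \<Rightarrow> ('a \<Rightarrow> 'b::metric_space) \<Rightarrow> bool" where
  "locally_lipschitz_on S f \<longleftrightarrow> (\<forall>x\<in>S. \<exists>u>0. \<exists>K. K-lipschitz_on (cball x u \<inter> S) f)"

definition linear_growth_on :: "'a::real_normed_vector set \<Rightarrow> ('a \<Rightarrow> 'b::real_normed_vector) \<Rightarrow> bool" where
  "linear_growth_on S f \<longleftrightarrow> (\<exists>K. \<forall>x\<in>S. norm (f x) \<le> K * (1 + norm x))"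

definition test_function :: "real set \<Rightarrow> (real \<Rightarrow> real) \<Rightarrow> bool" where
  "test_function S \<phi> \<longleftrightarrow>
     (\<forall>n x. ((deriv ^^ n) \<phi>) differentiable (at x)) \<and>
     (\<exists>K. compact K \<and> K \<subseteq> S \<and> (\<forall>x. x \<notin> K \<longrightarrow> \<phi> x = 0))"

definition Linf_loc :: "real set \<Rightarrow> (real \<Rightarrow> real) \<Rightarrow> bool" where
  "Linf_loc S f \<longleftrightarrow> set_borel_measurable lebesgue S f \<and>
     (\<forall>K. compact K \<and> K \<subseteq> S \<longrightarrow> (\<exists>B. AE x in lebesgue. x \<in> K \<longrightarrow> \<bar>f x\<bar> \<le> B))"

definition W1inf_loc :: "real set \<Rightarrow> (real \<Rightarrow> real) \<Rightarrow> bool" where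
  "W1inf_loc S f \<longleftrightarrow> Linf_loc S f \<and>
     (\<exists>g. Linf_loc S g \<and>
        (\<forall>\<phi>. test_function S \<phi> \<longrightarrow>
           (LINT x:S|lebesgue. f x * deriv \<phi> x) = - (LINT x:S|lebesgue. g x * \<phi> x)))"

section \<open>Stochastic processes\<close>

text \<open>
  Processes are indexed by \<^typ>\<open>real\<close>, only times \<open>t \<ge> 0\<close> being relevant.  Filtrations are
  indexed by \<^typ>\<open>ennreal\<close>, so that \<^const>\<open>stopping_time\<close> is the notion of a
  \<open>[0,\<infinity>]\<close>-valued stopping time.  Path properties are required almost surely.
\<close>

definition usual_conditions :: "'a measure \<Rightarrow> (ennreal \<Rightarrow> 'a measure) \<Rightarrow> bool" where
  "usual_conditions M F \<longleftrightarrow>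
     filtration (space M) F \<and> (\<forall>t. sets (F t) \<subseteq> sets M) \<and>
     complete_measure M \<and> null_sets M \<subseteq> sets (F 0) \<and>
     (\<forall>t<\<infinity>. sets (F t) = (\<Inter>s\<in>{t<..}. sets (F s)))"

definition adapted :: "(ennreal \<Rightarrow> 'a measure) \<Rightarrow> (real \<Rightarrow> 'a \<Rightarrow> 'b::topological_space) \<Rightarrow> bool" where
  "adapted F Z \<longleftrightarrow> (\<forall>t\<ge>0. Z t \<in> borel_measurable (F (ennreal t)))"

definition continuous_paths :: "'a measure \<Rightarrow> (real \<Rightarrow> 'a \<Rightarrow> 'b::topological_space) \<Rightarrow> bool" where
  "continuous_paths M Z \<longleftrightarrow> (AE \<omega> in M. continuous_on {0..} (\<lambda>t. Z t \<omega>))"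

definition cadlag_paths :: "'a measure \<Rightarrow> (real \<Rightarrow> 'a \<Rightarrow> real) \<Rightarrow> bool" where
  "cadlag_paths M Z \<longleftrightarrow> (AE \<omega> in M.
     (\<forall>t\<ge>0. ((\<lambda>s. Z s \<omega>) \<longlongrightarrow> Z t \<omega>) (at_right t)) \<and>
     (\<forall>t>0. \<exists>l. ((\<lambda>s. Z s \<omega>) \<longlongrightarrow> l) (at_left t)))"

definition continuous_increasing :: "'a measure \<Rightarrow> (real \<Rightarrow> 'a \<Rightarrow> real) \<Rightarrow> bool" where
  "continuous_increasing M Z \<longleftrightarrow> continuous_paths M Z \<and>
     (AE \<omega> in M. Z 0 \<omega> = 0 \<and> mono_on {0..} (\<lambda>t. Z t \<omega>))"

text \<open>The Lebesgue--Stieltjes measure \<open>dN\<close> on \<open>[0,\<infinity>)\<close> of a continuous nondecreasing path.\<close>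

definition path_measure :: "(real \<Rightarrow> real) \<Rightarrow> real measure" where
  "path_measure N = interval_measure (\<lambda>t. N (max 0 t))"

definition null_in_prob :: "'a measure \<Rightarrow> ('i \<Rightarrow> 'a \<Rightarrow> ennreal) \<Rightarrow> 'i filter \<Rightarrow> bool" where
  "null_in_prob M f U \<longleftrightarrow>
     (\<forall>\<^sub>F i in U. f i \<in> borel_measurable M) \<and>
     (\<forall>\<epsilon>>0. ((\<lambda>i. measure M {\<omega> \<in> space M. ennreal \<epsilon> < f i \<omega>}) \<longlongrightarrow> 0) U)"

definition brownian_motion ::
    "'a measure \<Rightarrow> (ennreal \<Rightarrow> 'a measure) \<Rightarrow> (real \<Rightarrow> 'a \<Rightarrow> real^2) \<Rightarrow> bool" where
  "brownian_motion M F W \<longleftrightarrow>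
     adapted F W \<and> continuous_paths M W \<and> (AE \<omega> in M. W 0 \<omega> = 0) \<and>
     (\<forall>s t. 0 \<le> s \<and> s < t \<longrightarrow>
        distributed M lborel (\<lambda>\<omega>. W t \<omega> - W s \<omega>)
          (\<lambda>z. ennreal (\<Prod>i\<in>UNIV. normal_density 0 (sqrt (t - s)) (z $ i))) \<and>
        prob_space.indep_set M (sets (F (ennreal s)))
          (sets (vimage_algebra (space M) (\<lambda>\<omega>. W t \<omega> - W s \<omega>) borel)))"

definition augmented_filtration :: "'a measure \<Rightarrow> (real \<Rightarrow> 'a \<Rightarrow> real^2) \<Rightarrow> ennreal \<Rightarrow> 'a measure" where
  "augmented_filtration M W t = sigma (space M)
     ({W s -` B \<inter> space M | s B. 0 \<le> s \<and> ennreal s \<le> t \<and> B \<in> sets borel} \<union> null_sets M)"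

definition martingale :: "'a measure \<Rightarrow> (ennreal \<Rightarrow> 'a measure) \<Rightarrow> (real \<Rightarrow> 'a \<Rightarrow> real) \<Rightarrow> bool" where
  "martingale M F N \<longleftrightarrow> adapted F N \<and> (\<forall>t\<ge>0. integrable M (N t)) \<and>
     (\<forall>s t. 0 \<le> s \<and> s \<le> t \<longrightarrow>
        (AE \<omega> in M. real_cond_exp M (F (ennreal s)) (N t) \<omega> = N s \<omega>))"

definition local_martingale ::
    "'a measure \<Rightarrow> (ennreal \<Rightarrow> 'a measure) \<Rightarrow> (real \<Rightarrow> 'a \<Rightarrow> real) \<Rightarrow> bool" where
  "local_martingale M F N \<longleftrightarrow> adapted F N \<and> cadlag_paths M N \<and>
     (\<exists>\<rho>. (\<forall>n. stopping_time F (\<rho> n)) \<and>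
        (AE \<omega> in M. incseq (\<lambda>n. \<rho> n \<omega>) \<and> (\<lambda>n. \<rho> n \<omega>) \<longlonglongrightarrow> \<infinity>) \<and>
        (\<forall>n::nat. martingale M F
           (\<lambda>t \<omega>. N (enn2real (min (ennreal t) (\<rho> n \<omega>))) \<omega> - N 0 \<omega>)))"

subsection \<open>Ito integral against a scalar Brownian motion\<close>

text \<open>
  The elementary integrand with data \<open>(n, t, \<xi>)\<close> is the process equal to \<open>\<xi> i\<close> on
  \<open>(t i, t (i + 1)]\<close> for \<open>i < n\<close>, and zero elsewhere.  The integral of a general integrand is a
  limit, uniformly on compacts in probability, of elementary integrals.
\<close>

definition elementary_integrand ::
    "(ennreal \<Rightarrow> 'a measure) \<Rightarrow> nat \<Rightarrow> (nat \<Rightarrow> real) \<Rightarrow> (nat \<Rightarrow> 'a \<Rightarrow> real) \<Rightarrow> bool" where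
  "elementary_integrand F n t \<xi> \<longleftrightarrow> 0 \<le> t 0 \<and>
     (\<forall>i<n. t i < t (Suc i) \<and> \<xi> i \<in> borel_measurable (F (ennreal (t i))) \<and>
        (\<exists>K. \<forall>\<omega> \<in> space (F (ennreal (t i))). \<bar>\<xi> i \<omega>\<bar> \<le> K))"

definition elementary_process ::
    "nat \<Rightarrow> (nat \<Rightarrow> real) \<Rightarrow> (nat \<Rightarrow> 'a \<Rightarrow> real) \<Rightarrow> real \<Rightarrow> 'a \<Rightarrow> real" where
  "elementary_process n t \<xi> s \<omega> = (\<Sum>i<n. \<xi> i \<omega> * indicator {t i<..t (Suc i)} s)"

definition elementary_integral ::
    "nat \<Rightarrow> (nat \<Rightarrow> real) \<Rightarrow> (nat \<Rightarrow> 'a \<Rightarrow> real) \<Rightarrow> (real \<Rightarrow> 'a \<Rightarrow> real) \<Rightarrow> real \<Rightarrow> 'a \<Rightarrow> real" where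
  "elementary_integral n t \<xi> B s \<omega> =
     (\<Sum>i<n. \<xi> i \<omega> * (B (min s (t (Suc i))) \<omega> - B (min s (t i)) \<omega>))"

definition ito_integral ::
    "'a measure \<Rightarrow> (ennreal \<Rightarrow> 'a measure) \<Rightarrow> (real \<Rightarrow> 'a \<Rightarrow> real) \<Rightarrow> (real \<Rightarrow> 'a \<Rightarrow> real)
      \<Rightarrow> (real \<Rightarrow> 'a \<Rightarrow> real) \<Rightarrow> bool" where
  "ito_integral M F B H J \<longleftrightarrow>
     adapted F H \<and> (AE \<omega> in M. \<forall>T\<ge>0. set_borel_measurable borel {0..T} (\<lambda>s. H s \<omega>)) \<and>
     adapted F J \<and> continuous_paths M J \<and>
     (\<exists>n t \<xi>. (\<forall>k. elementary_integrand F (n k) (t k) (\<xi> k)) \<and>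
        (\<forall>T\<ge>0.
           null_in_prob M
             (\<lambda>k \<omega>. \<integral>\<^sup>+ s\<in>{0..T}.
                ennreal ((elementary_process (n k) (t k) (\<xi> k) s \<omega> - H s \<omega>)\<^sup>2) \<partial>lborel)
             sequentially \<and>
           null_in_prob M
             (\<lambda>k \<omega>. SUP s\<in>{0..T}.
                ennreal \<bar>elementary_integral (n k) (t k) (\<xi> k) B s \<omega> - J s \<omega>\<bar>)
             sequentially))"

subsection \<open>Quadratic variation and symmetric local time at zero\<close>

definition quadratic_variation ::
    "'a measure \<Rightarrow> (real \<Rightarrow> 'a \<Rightarrow> real) \<Rightarrow> (real \<Rightarrow> 'a \<Rightarrow> real) \<Rightarrow> bool" where
  "quadratic_variation M Y Q \<longleftrightarrow> continuous_increasing M Q \<and>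
     (\<forall>t\<ge>0. \<forall>(m :: nat \<Rightarrow> nat) (\<pi> :: nat \<Rightarrow> nat \<Rightarrow> real).
        (\<forall>n. \<pi> n 0 = 0 \<and> \<pi> n (m n) = t \<and> (\<forall>k<m n. \<pi> n k \<le> \<pi> n (Suc k))) \<and>
        (\<forall>\<delta>>0. \<forall>\<^sub>F n in sequentially. \<forall>k<m n. \<pi> n (Suc k) - \<pi> n k < \<delta>) \<longrightarrow>
        null_in_prob M
          (\<lambda>n \<omega>. ennreal \<bar>(\<Sum>k<m n. (Y (\<pi> n (Suc k)) \<omega> - Y (\<pi> n k) \<omega>)\<^sup>2) - Q t \<omega>\<bar>)
          sequentially)"

text \<open>\<open>l t\<close> is the limit in probability of \<open>1/(2\<epsilon>) \<integral>\<^sub>0\<^sup>t 1{|Y s| < \<epsilon>} d\<langle>Y\<rangle> s\<close> as \<open>\<epsilon> \<down> 0\<close>.\<close>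

definition symmetric_local_time ::
    "'a measure \<Rightarrow> (real \<Rightarrow> 'a \<Rightarrow> real) \<Rightarrow> (real \<Rightarrow> 'a \<Rightarrow> real) \<Rightarrow> bool" where
  "symmetric_local_time M Y l \<longleftrightarrow> continuous_increasing M l \<and>
     (\<exists>Q. quadratic_variation M Y Q \<and>
        (\<forall>t\<ge>0. null_in_prob M
           (\<lambda>\<epsilon> \<omega>. ennreal \<bar>measure (path_measure (\<lambda>s. Q s \<omega>)) {s \<in> {0..t}. \<bar>Y s \<omega>\<bar> < \<epsilon>} / (2 * \<epsilon>)
                         - l t \<omega>\<bar>)
           (at_right 0)))"

section \<open>Normally reflected diffusions in the quadrant\<close>

definition reflected_solution ::
    "'a measure \<Rightarrow> (ennreal \<Rightarrow> 'a measure) \<Rightarrow> (real \<Rightarrow> 'a \<Rightarrow> real^2) \<Rightarrow>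
     (real^2 \<Rightarrow> real^2) \<Rightarrow> (real^2 \<Rightarrow> real^2^2) \<Rightarrow> real^2 \<Rightarrow>
     (real \<Rightarrow> 'a \<Rightarrow> real^2) \<Rightarrow> (real \<Rightarrow> 'a \<Rightarrow> real^2) \<Rightarrow> bool" where
  "reflected_solution M F W \<mu> \<sigma> x X L \<longleftrightarrow>
     adapted F X \<and> continuous_paths M X \<and> (AE \<omega> in M. \<forall>t\<ge>0. X t \<omega> \<in> quadrant) \<and>
     adapted F L \<and> (\<forall>i. continuous_increasing M (\<lambda>t \<omega>. L t \<omega> $ i)) \<and>
     (\<forall>i. AE \<omega> in M.
        emeasure (path_measure (\<lambda>t. L t \<omega> $ i)) {t \<in> {0..}. X t \<omega> $ i > 0} = 0) \<and>
     (\<exists>J :: 2 \<Rightarrow> 2 \<Rightarrow> real \<Rightarrow> 'a \<Rightarrow> real.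
        (\<forall>i j. ito_integral M F (\<lambda>t \<omega>. W t \<omega> $ j) (\<lambda>t \<omega>. \<sigma> (X t \<omega>) $ i $ j) (J i j)) \<and>
        (AE \<omega> in M. \<forall>t\<ge>0. \<forall>i.
           X t \<omega> $ i = x $ i + (LBINT s:{0..t}. \<mu> (X s \<omega>) $ i) + (\<Sum>j\<in>UNIV. J i j t \<omega>) + L t \<omega> $ i))"

definition strong_solution ::
    "'a measure \<Rightarrow> (ennreal \<Rightarrow> 'a measure) \<Rightarrow> (real \<Rightarrow> 'a \<Rightarrow> real^2) \<Rightarrow>
     (real^2 \<Rightarrow> real^2) \<Rightarrow> (real^2 \<Rightarrow> real^2^2) \<Rightarrow> real^2 \<Rightarrow>
     (real \<Rightarrow> 'a \<Rightarrow> real^2) \<Rightarrow> (real \<Rightarrow> 'a \<Rightarrow> real^2) \<Rightarrow> bool" where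
  "strong_solution M F W \<mu> \<sigma> x X L \<longleftrightarrow>
     reflected_solution M F W \<mu> \<sigma> x X L \<and> adapted (augmented_filtration M W) X"

text \<open>A family \<open>X\<close> of processes indexed by the starting point; \<open>E\<^sub>y f(X\<^sub>t)\<close> is
  \<open>E f(X y t)\<close>.\<close>

definition strong_markov ::
    "'a measure \<Rightarrow> (ennreal \<Rightarrow> 'a measure) \<Rightarrow> (real^2 \<Rightarrow> real \<Rightarrow> 'a \<Rightarrow> real^2) \<Rightarrow> bool" where
  "strong_markov M F X \<longleftrightarrow>
     (\<forall>(f :: real^2 \<Rightarrow> real) t. f \<in> borel_measurable borel \<and> bounded (range f) \<and> 0 \<le> t \<longrightarrow>
        set_borel_measurable borel quadrant (\<lambda>y. \<integral>\<omega>. f (X y t \<omega>) \<partial>M) \<and>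
        (\<forall>x\<in>quadrant. \<forall>\<tau>. stopping_time F \<tau> \<longrightarrow>
           (AE \<omega> in M.
              real_cond_exp M (filtration.pre_sigma (space M) F \<tau>)
                (\<lambda>\<omega>. if \<tau> \<omega> < \<infinity> then f (X x (enn2real (\<tau> \<omega>) + t) \<omega>) else 0) \<omega> =
              (if \<tau> \<omega> < \<infinity> then \<integral>\<omega>'. f (X (X x (enn2real (\<tau> \<omega>)) \<omega>) t \<omega>') \<partial>M else 0))))"

section \<open>The optimal stopping problem\<close>

definition G :: "real \<Rightarrow> real^2 \<Rightarrow> real" where
  "G \<alpha> x = max (x $ 1) (\<alpha> * x $ 2)"

text \<open>In the following, \<open>Z\<close> is a process started at a fixed point, such as \<open>X x\<close>.\<close>

definition discounted_gain ::
    "real \<Rightarrow> real \<Rightarrow> (real \<Rightarrow> 'a \<Rightarrow> real^2) \<Rightarrow> ('a \<Rightarrow> ennreal) \<Rightarrow> 'a \<Rightarrow> real" where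
  "discounted_gain r \<alpha> Z \<tau> \<omega> =
     (if \<tau> \<omega> = \<infinity> then 0
      else exp (- r * enn2real (\<tau> \<omega>)) * G \<alpha> (Z (enn2real (\<tau> \<omega>)) \<omega>))"

definition running_cost ::
    "real \<Rightarrow> (real^2 \<Rightarrow> real) \<Rightarrow> (real \<Rightarrow> 'a \<Rightarrow> real^2) \<Rightarrow> ('a \<Rightarrow> ennreal) \<Rightarrow> 'a \<Rightarrow> ennreal" where
  "running_cost r c Z \<tau> \<omega> =
     (\<integral>\<^sup>+ s\<in>{s. 0 \<le> s \<and> ennreal s \<le> \<tau> \<omega>}. ennreal (exp (- r * s) * c (Z s \<omega>)) \<partial>lborel)"

definition payoff_integrable ::
    "'a measure \<Rightarrow> real \<Rightarrow> real \<Rightarrow> (real^2 \<Rightarrow> real) \<Rightarrow> (real \<Rightarrow> 'a \<Rightarrow> real^2) \<Rightarrow> ('a \<Rightarrow> ennreal) \<Rightarrow> bool"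
  where
  "payoff_integrable M r \<alpha> c Z \<tau> \<longleftrightarrow>
     integrable M (discounted_gain r \<alpha> Z \<tau>) \<and>
     running_cost r c Z \<tau> \<in> borel_measurable M \<and> (\<integral>\<^sup>+ \<omega>. running_cost r c Z \<tau> \<omega> \<partial>M) < \<infinity>"

definition expected_payoff ::
    "'a measure \<Rightarrow> real \<Rightarrow> real \<Rightarrow> (real^2 \<Rightarrow> real) \<Rightarrow> (real \<Rightarrow> 'a \<Rightarrow> real^2) \<Rightarrow> ('a \<Rightarrow> ennreal) \<Rightarrow> real"
  where
  "expected_payoff M r \<alpha> c Z \<tau> =
     (\<integral>\<omega>. discounted_gain r \<alpha> Z \<tau> \<omega> - enn2real (running_cost r c Z \<tau> \<omega>) \<partial>M)"

definition value_ereal ::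
    "'a measure \<Rightarrow> (ennreal \<Rightarrow> 'a measure) \<Rightarrow> real \<Rightarrow> real \<Rightarrow> (real^2 \<Rightarrow> real) \<Rightarrow>
     (real^2 \<Rightarrow> real \<Rightarrow> 'a \<Rightarrow> real^2) \<Rightarrow> real^2 \<Rightarrow> ereal" where
  "value_ereal M F r \<alpha> c X x =
     (SUP \<tau>\<in>{\<tau>. stopping_time F \<tau>}. ereal (expected_payoff M r \<alpha> c (X x) \<tau>))"

definition value_function ::
    "'a measure \<Rightarrow> (ennreal \<Rightarrow> 'a measure) \<Rightarrow> real \<Rightarrow> real \<Rightarrow> (real^2 \<Rightarrow> real) \<Rightarrow>
     (real^2 \<Rightarrow> real \<Rightarrow> 'a \<Rightarrow> real^2) \<Rightarrow> real^2 \<Rightarrow> real" where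
  "value_function M F r \<alpha> c X x = real_of_ereal (value_ereal M F r \<alpha> c X x)"

definition optimal_stopping_time ::
    "'a measure \<Rightarrow> (ennreal \<Rightarrow> 'a measure) \<Rightarrow> real \<Rightarrow> real \<Rightarrow> (real^2 \<Rightarrow> real) \<Rightarrow>
     (real^2 \<Rightarrow> real \<Rightarrow> 'a \<Rightarrow> real^2) \<Rightarrow> real^2 \<Rightarrow> ('a \<Rightarrow> ennreal) \<Rightarrow> bool" where
  "optimal_stopping_time M F r \<alpha> c X x \<tau> \<longleftrightarrow> stopping_time F \<tau> \<and>
     ereal (expected_payoff M r \<alpha> c (X x) \<tau>) = value_ereal M F r \<alpha> c X x"

definition entry_time :: "(real^2) set \<Rightarrow> (real \<Rightarrow> 'a \<Rightarrow> real^2) \<Rightarrow> 'a \<Rightarrow> ennreal" where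
  "entry_time D Z \<omega> = Inf (ennreal ` {t. 0 \<le> t \<and> Z t \<omega> \<in> D})"

section \<open>Stopping-gain functional and killed resolvent\<close>

definition diagonal :: "real \<Rightarrow> (real^2) set" where
  "diagonal \<alpha> = {x \<in> quadrant. x $ 1 = \<alpha> * x $ 2}"

definition Gamma_ac ::
    "real \<Rightarrow> real \<Rightarrow> (real^2 \<Rightarrow> real^2) \<Rightarrow> (real^2 \<Rightarrow> real) \<Rightarrow> real^2 \<Rightarrow> real" where
  "Gamma_ac r \<alpha> \<mu> c x =
     (if x $ 1 > \<alpha> * x $ 2 then c x + r * x $ 1 - \<mu> x $ 1
      else if x $ 1 < \<alpha> * x $ 2 then c x + r * \<alpha> * x $ 2 - \<alpha> * \<mu> x $ 2
      else 0)"

text \<open>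
  The additive functional of \<open>\<Gamma> = \<Gamma>\<^sup>a\<^sup>c dx + \<Gamma>\<^sup>\<Delta>\<close>, and those of the positive and negative parts
  \<open>\<Gamma>\<^sup>+\<close>, \<open>\<Gamma>\<^sup>-\<close>.  The density \<open>- q / (2 sqrt (1 + \<alpha>\<^sup>2))\<close> of \<open>\<Gamma>\<^sup>\<Delta>\<close> with respect to surface
  measure on the diagonal is negative, because \<open>q(x) = \<xi>\<^sup>T a(x) \<xi>\<close> for \<open>\<xi> = (1, -\<alpha>)\<close>.  Since
  \<open>\<Gamma>\<^sup>\<Delta>\<close> and \<open>dx\<close> are mutually singular, \<open>\<Gamma>\<^sup>+ = (\<Gamma>\<^sup>a\<^sup>c)\<^sup>+ dx\<close> and
  \<open>\<Gamma>\<^sup>- = (\<Gamma>\<^sup>a\<^sup>c)\<^sup>- dx - \<Gamma>\<^sup>\<Delta>\<close>, so that the whole local-time term belongs to \<open>\<Gamma>\<^sup>-\<close>.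
  The argument \<open>l\<close> is the symmetric local time at zero of \<open>Z $ 1 - \<alpha> * Z $ 2\<close>.
\<close>

definition Gamma_functional ::
    "real \<Rightarrow> real \<Rightarrow> (real^2 \<Rightarrow> real^2) \<Rightarrow> (real^2 \<Rightarrow> real) \<Rightarrow>
     (real \<Rightarrow> 'a \<Rightarrow> real^2) \<Rightarrow> (real \<Rightarrow> 'a \<Rightarrow> real) \<Rightarrow> real \<Rightarrow> 'a \<Rightarrow> real" where
  "Gamma_functional r \<alpha> \<mu> c Z l t \<omega> =
     (LBINT s:{0..t}. Gamma_ac r \<alpha> \<mu> c (Z s \<omega>) * indicator (- diagonal \<alpha>) (Z s \<omega>)) - l t \<omega> / 2"

definition Gamma_pos_functional ::
    "real \<Rightarrow> real \<Rightarrow> (real^2 \<Rightarrow> real^2) \<Rightarrow> (real^2 \<Rightarrow> real) \<Rightarrow>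
     (real \<Rightarrow> 'a \<Rightarrow> real^2) \<Rightarrow> real \<Rightarrow> 'a \<Rightarrow> real" where
  "Gamma_pos_functional r \<alpha> \<mu> c Z t \<omega> =
     (LBINT s:{0..t}. max 0 (Gamma_ac r \<alpha> \<mu> c (Z s \<omega>)) * indicator (- diagonal \<alpha>) (Z s \<omega>))"

definition Gamma_neg_functional ::
    "real \<Rightarrow> real \<Rightarrow> (real^2 \<Rightarrow> real^2) \<Rightarrow> (real^2 \<Rightarrow> real) \<Rightarrow>
     (real \<Rightarrow> 'a \<Rightarrow> real^2) \<Rightarrow> (real \<Rightarrow> 'a \<Rightarrow> real) \<Rightarrow> real \<Rightarrow> 'a \<Rightarrow> real" where
  "Gamma_neg_functional r \<alpha> \<mu> c Z l t \<omega> =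
     (LBINT s:{0..t}. max 0 (- Gamma_ac r \<alpha> \<mu> c (Z s \<omega>)) * indicator (- diagonal \<alpha>) (Z s \<omega>))
     + l t \<omega> / 2"

lemma Gamma_functional_decomposition:
  assumes "set_integrable lborel {0..t}
             (\<lambda>s. Gamma_ac r \<alpha> \<mu> c (Z s \<omega>) * indicator (- diagonal \<alpha>) (Z s \<omega>))"
  shows "Gamma_functional r \<alpha> \<mu> c Z l t \<omega> =
           Gamma_pos_functional r \<alpha> \<mu> c Z t \<omega> - Gamma_neg_functional r \<alpha> \<mu> c Z l t \<omega>"
proof -
  define h where "h s = Gamma_ac r \<alpha> \<mu> c (Z s \<omega>) * indicator (- diagonal \<alpha>) (Z s \<omega>)" for s
  have i: "integrable lborel (\<lambda>s. indicator {0..t} s *\<^sub>R h s)"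
    using assms unfolding set_integrable_def h_def .
  have p: "indicator {0..t} s *\<^sub>R (max 0 (Gamma_ac r \<alpha> \<mu> c (Z s \<omega>)) * indicator (- diagonal \<alpha>) (Z s \<omega>))
      = max 0 (indicator {0..t} s *\<^sub>R h s)"
    and n: "indicator {0..t} s *\<^sub>R (max 0 (- Gamma_ac r \<alpha> \<mu> c (Z s \<omega>)) * indicator (- diagonal \<alpha>) (Z s \<omega>))
      = max 0 (- (indicator {0..t} s *\<^sub>R h s))" for s
    by (auto simp: h_def indicator_def)
  have "(LBINT s. max 0 (indicator {0..t} s *\<^sub>R h s)) - (LBINT s. max 0 (- (indicator {0..t} s *\<^sub>R h s)))
      = (LBINT s. max 0 (indicator {0..t} s *\<^sub>R h s) - max 0 (- (indicator {0..t} s *\<^sub>R h s)))"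
    using i by (intro Bochner_Integration.integral_diff[symmetric]) auto
  also have "\<dots> = (LBINT s. indicator {0..t} s *\<^sub>R h s)"
    by (intro Bochner_Integration.integral_cong) (auto simp: max_def)
  finally show ?thesis
    unfolding Gamma_functional_def Gamma_pos_functional_def Gamma_neg_functional_def
      set_lebesgue_integral_def p n by (simp add: h_def)
qed

text \<open>\<open>\<integral>\<^sub>0\<^sup>\<tau> e\<^sup>-\<^sup>r\<^sup>s dA s\<close> for a continuous nondecreasing functional \<open>A\<close>, and for the signed
  functional \<open>A = P - N\<close> with \<open>P\<close>, \<open>N\<close> of this kind.\<close>

definition discounted_integral ::
    "real \<Rightarrow> (real \<Rightarrow> 'a \<Rightarrow> real) \<Rightarrow> ('a \<Rightarrow> ennreal) \<Rightarrow> 'a \<Rightarrow> ennreal" where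
  "discounted_integral r A \<tau> \<omega> =
     (\<integral>\<^sup>+ s\<in>{s. 0 \<le> s \<and> ennreal s \<le> \<tau> \<omega>}. ennreal (exp (- r * s)) \<partial>path_measure (\<lambda>t. A t \<omega>))"

definition signed_discounted_integral ::
    "real \<Rightarrow> (real \<Rightarrow> 'a \<Rightarrow> real) \<Rightarrow> (real \<Rightarrow> 'a \<Rightarrow> real) \<Rightarrow> ('a \<Rightarrow> ennreal) \<Rightarrow> 'a \<Rightarrow> real" where
  "signed_discounted_integral r P N \<tau> \<omega> =
     enn2real (discounted_integral r P \<tau> \<omega>) - enn2real (discounted_integral r N \<tau> \<omega>)"

definition killed_resolvent_nonneg ::
    "'a measure \<Rightarrow> real \<Rightarrow> (real^2) set \<Rightarrow> (real^2 \<Rightarrow> real \<Rightarrow> 'a \<Rightarrow> real^2) \<Rightarrow>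
     (real^2 \<Rightarrow> real \<Rightarrow> 'a \<Rightarrow> real) \<Rightarrow> real^2 \<Rightarrow> ennreal" where
  "killed_resolvent_nonneg M r D X A x =
     (\<integral>\<^sup>+ \<omega>. discounted_integral r (A x) (entry_time D (X x)) \<omega> \<partial>M)"

definition killed_resolvent ::
    "'a measure \<Rightarrow> real \<Rightarrow> (real^2) set \<Rightarrow> (real^2 \<Rightarrow> real \<Rightarrow> 'a \<Rightarrow> real^2) \<Rightarrow>
     (real^2 \<Rightarrow> real \<Rightarrow> 'a \<Rightarrow> real) \<Rightarrow> (real^2 \<Rightarrow> real \<Rightarrow> 'a \<Rightarrow> real) \<Rightarrow> real^2 \<Rightarrow> real" where
  "killed_resolvent M r D X P N x =
     (\<integral>\<omega>. signed_discounted_integral r (P x) (N x) (entry_time D (X x)) \<omega> \<partial>M)"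

text \<open>The non-tangential approach region of aperture \<open>\<kappa>\<close> at \<open>z\<close>; the boundary of \<open>C\<close> is taken
  relative to the state space.\<close>

definition nontangential_region :: "real \<Rightarrow> (real^2) set \<Rightarrow> real^2 \<Rightarrow> (real^2) set" where
  "nontangential_region \<kappa> C z =
     {x \<in> C. dist x z \<le> (1 + \<kappa>) * infdist x ((top_of_set quadrant) frontier_of C)}"

section \<open>Standing assumptions\<close>

locale reflected_stopping = prob_space M
  for M :: "'a measure" +
  fixes F :: "ennreal \<Rightarrow> 'a measure"
    and W :: "real \<Rightarrow> 'a \<Rightarrow> real^2"
    and \<mu> :: "real^2 \<Rightarrow> real^2"
    and \<sigma> :: "real^2 \<Rightarrow> real^2^2"
    and r \<alpha> :: real
    and c :: "real^2 \<Rightarrow> real"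
    and X L :: "real^2 \<Rightarrow> real \<Rightarrow> 'a \<Rightarrow> real^2"
    and l :: "real^2 \<Rightarrow> real \<Rightarrow> 'a \<Rightarrow> real"
  assumes r_pos: "0 < r"
    and alpha_pos: "0 < \<alpha>"
    and usual: "usual_conditions M F"
    and brownian: "brownian_motion M F W"
    and coefficients:
      "locally_lipschitz_on quadrant \<mu>" "linear_growth_on quadrant \<mu>"
      "locally_lipschitz_on quadrant \<sigma>" "linear_growth_on quadrant \<sigma>"
    and elliptic:
      "\<And>K. compact K \<Longrightarrow> K \<subseteq> quadrant \<Longrightarrow>
         \<exists>k>0. \<forall>x\<in>K. \<forall>\<xi>. k * (norm \<xi>)\<^sup>2 \<le> \<xi> \<bullet> ((\<sigma> x ** transpose (\<sigma> x)) *v \<xi>)"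
    and solution: "\<And>x. x \<in> quadrant \<Longrightarrow> strong_solution M F W \<mu> \<sigma> x (X x) (L x)"
    and solution_unique:
      "\<And>x X' L'. x \<in> quadrant \<Longrightarrow> strong_solution M F W \<mu> \<sigma> x X' L' \<Longrightarrow>
         AE \<omega> in M. \<forall>t\<ge>0. X' t \<omega> = X x t \<omega> \<and> L' t \<omega> = L x t \<omega>"
    and markov: "strong_markov M F X"
    and flow_continuity:
      "\<And>T K. 0 < T \<Longrightarrow> compact K \<Longrightarrow> K \<subseteq> quadrant \<Longrightarrow>
         \<exists>q\<ge>1. \<forall>x\<in>K.
           ((\<lambda>y. \<integral>\<^sup>+ \<omega>. (SUP t\<in>{0..T}. ennreal (norm (X y t \<omega> - X x t \<omega>) powr q)) \<partial>M) \<longlongrightarrow> 0)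
             (at x within quadrant)"
    and cost: "continuous_on quadrant c" "\<And>x. x \<in> quadrant \<Longrightarrow> 0 \<le> c x"
    and value_growth:
      "\<exists>K>0. \<exists>p\<ge>1. \<forall>x\<in>quadrant.
         0 \<le> value_ereal M F r \<alpha> c X x \<and>
         value_ereal M F r \<alpha> c X x \<le> ereal (K * (1 + norm x powr p))"
    and payoffs:
      "\<And>x \<tau>. x \<in> quadrant \<Longrightarrow> stopping_time F \<tau> \<Longrightarrow> payoff_integrable M r \<alpha> c (X x) \<tau>"
    and local_time:
      "\<And>x. x \<in> quadrant \<Longrightarrow>
         symmetric_local_time M (\<lambda>t \<omega>. X x t \<omega> $ 1 - \<alpha> * X x t \<omega> $ 2) (l x)"
    \<comment> \<open>Off the corner the reflection terms cancel in the Ito-Tanaka formula for \<open>G(X)\<close>; at the corner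
        they contribute \<open>(1/2) 1{X = 0} d(L$1 + \<alpha> L$2)\<close>.\<close>
    and corner:
      "\<And>x i. x \<in> quadrant \<Longrightarrow>
         AE \<omega> in M. emeasure (path_measure (\<lambda>t. L x t \<omega> $ i)) {t \<in> {0..}. X x t \<omega> = 0} = 0"

end

theory Submission
  imports Defs
begin

text \<open>
  Taking expectations in the Ito--Tanaka identity along \<open>\<sigma>\<^sub>k \<up> \<tau>\<^sub>D\<close> and using that \<open>\<tau>\<^sub>D\<close> is
  optimal gives \<open>R\<Gamma> = G - V\<close> on the whole quadrant.  The right-hand side is continuous and vanishes
  on the boundary curve, which lies in the closed set \<open>D\<close>.
\<close>

text \<open>Once the pair is written as a \<open>\<chi>\<close> abstraction, continuity can be
  checked coordinate by coordinate: one is constant, the other is the identity. This restricts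
  continuous functions on the quadrant to vertical rays.\<close>

lemma continuous_on_vector_2:
  "continuous_on S (\<lambda>t. vector [u, t] :: real^2)"
proof -
  have "(vector [u, t] :: real^2) = (\<chi> i. if i = 1 then u else t)" for t
    by (simp add: vec_eq_iff forall_2 vector_2)
  moreover have "continuous_on S (\<lambda>t. \<chi> i::2. if i = 1 then u else t)"
  proof (rule continuous_on_vec_lambda)
    show "continuous_on S (\<lambda>t. if i = 1 then u else t)" for i :: 2
      by (cases "i = 1") auto
  qed
  ultimately show ?thesis
    by simp
qed

lemma vector_2_in_quadrant_iff: "vector [u, v] \<in> quadrant \<longleftrightarrow> 0 \<le> u \<and> 0 \<le> v"
  by (auto simp: quadrant_def forall_2 vector_2)

lemma continuous_on_G: "continuous_on S (G \<alpha>)"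
  unfolding G_def by (intro continuous_intros)

text \<open>The zero set is closed in the closed half-line, nonempty and bounded below by 0, hence
  contains its infimum. Applied to the gap \<open>G - V\<close> on a vertical ray, this puts the
  boundary point \<open>z x1\<close> into \<open>D\<close>.\<close>

lemma Inf_zero_set_attained:
  fixes g :: "real \<Rightarrow> real"
  assumes "continuous_on {0..} g" and "\<exists>t\<ge>0. g t = 0"
  shows "0 \<le> Inf {t. 0 \<le> t \<and> g t = 0}" and "g (Inf {t. 0 \<le> t \<and> g t = 0}) = 0"
proof -
  let ?S = "{t. 0 \<le> t \<and> g t = 0}"
  have "closed {t \<in> {0..}. g t = 0}"
    by (intro continuous_closed_preimage_constant assms(1)) simp
  then have "closed ?S"
    by (simp add: atLeast_def)
  then have "Inf ?S \<in> ?S"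
    using assms(2) by (intro closed_contains_Inf) (auto intro!: bdd_belowI[of _ 0])
  then show "0 \<le> Inf ?S" "g (Inf ?S) = 0"
    by auto
qed

theorem proposition5p5:
  fixes M :: "'a measure"
    and F :: "ennreal \<Rightarrow> 'a measure"
    and W :: "real \<Rightarrow> 'a \<Rightarrow> real^2"
    and \<mu> :: "real^2 \<Rightarrow> real^2"
    and \<sigma> :: "real^2 \<Rightarrow> real^2^2"
    and r \<alpha> :: real
    and c V R :: "real^2 \<Rightarrow> real"
    and X L :: "real^2 \<Rightarrow> real \<Rightarrow> 'a \<Rightarrow> real^2"
    and l A_pos A_neg :: "real^2 \<Rightarrow> real \<Rightarrow> 'a \<Rightarrow> real"
    and D C :: "(real^2) set"
    and \<tau>D :: "real^2 \<Rightarrow> 'a \<Rightarrow> ennreal"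
    and b :: "real \<Rightarrow> real"
    and z :: "real \<Rightarrow> real^2"
  assumes setting: "reflected_stopping M F W \<mu> \<sigma> r \<alpha> c X L l"
    and V_def: "V = value_function M F r \<alpha> c X"
    and D_def: "D = {x \<in> quadrant. V x = G \<alpha> x}"
    and C_def: "C = {x \<in> quadrant. V x > G \<alpha> x}"
    and tauD_def: "\<tau>D = (\<lambda>x. entry_time D (X x))"
    and A_pos_def: "A_pos = (\<lambda>x. Gamma_pos_functional r \<alpha> \<mu> c (X x))"
    and A_neg_def: "A_neg = (\<lambda>x. Gamma_neg_functional r \<alpha> \<mu> c (X x) (l x))"
    and R_def: "R = killed_resolvent M r D X A_pos A_neg"
    and b_def: "b = (\<lambda>x1. Inf {x2. 0 \<le> x2 \<and> vector [x1, x2] \<in> D})"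
    and z_def: "z = (\<lambda>x1. vector [x1, b x1])"
    and resolvent_finite:
      "\<forall>x\<in>quadrant. killed_resolvent_nonneg M r D X A_pos x
                    + killed_resolvent_nonneg M r D X A_neg x < \<infinity>"
    and V_continuous: "continuous_on quadrant V"
    and V_minus_G_antimono:
      "\<forall>x1\<ge>0. antimono_on {0..} (\<lambda>x2. V (vector [x1, x2]) - G \<alpha> (vector [x1, x2]))"
    and V_minus_G_vanishes:
      "\<forall>x1\<ge>0. \<exists>x2\<ge>0. V (vector [x1, x2]) - G \<alpha> (vector [x1, x2]) = 0"
    and b_continuous: "continuous_on {0<..} b"
    and b_sobolev: "W1inf_loc {0<..} b"
    and b_pos: "\<forall>u v. 0 < u \<and> u \<le> v \<longrightarrow> 0 < Inf (b ` {u..v})"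
    and optimal: "\<forall>x\<in>quadrant. optimal_stopping_time M F r \<alpha> c X x (\<tau>D x)"
    and ito_tanaka:
      "\<forall>x\<in>quadrant. \<exists>(N :: real \<Rightarrow> 'a \<Rightarrow> real) (s :: nat \<Rightarrow> 'a \<Rightarrow> ennreal).
         local_martingale M F N \<and>
         (\<forall>k. stopping_time F (s k) \<and> (\<exists>B. \<forall>\<omega>\<in>space M. s k \<omega> \<le> ennreal B)) \<and>
         (AE \<omega> in M. incseq (\<lambda>k. s k \<omega>) \<and> (\<lambda>k. s k \<omega>) \<longlonglongrightarrow> \<tau>D x \<omega>) \<and>
         (\<forall>k. AE \<omega> in M.
            discounted_gain r \<alpha> (X x) (s k) \<omega> =
              G \<alpha> x + enn2real (running_cost r c (X x) (s k) \<omega>)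
              - signed_discounted_integral r (A_pos x) (A_neg x) (s k) \<omega>
              + N (enn2real (s k \<omega>)) \<omega>) \<and>
         (\<forall>k. integrable M (\<lambda>\<omega>. N (enn2real (s k \<omega>)) \<omega>) \<and>
              (\<integral>\<omega>. N (enn2real (s k \<omega>)) \<omega> \<partial>M) = 0) \<and>
         (\<forall>k. integrable M (discounted_gain r \<alpha> (X x) (s k)) \<and>
              integrable M (\<lambda>\<omega>. enn2real (running_cost r c (X x) (s k) \<omega>)) \<and>
              integrable M (signed_discounted_integral r (A_pos x) (A_neg x) (s k))) \<and>
         integrable M (discounted_gain r \<alpha> (X x) (\<tau>D x)) \<and>
         integrable M (\<lambda>\<omega>. enn2real (running_cost r c (X x) (\<tau>D x) \<omega>)) \<and>
         integrable M (signed_discounted_integral r (A_pos x) (A_neg x) (\<tau>D x)) \<and>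
         (\<lambda>k. \<integral>\<omega>. discounted_gain r \<alpha> (X x) (s k) \<omega> \<partial>M)
           \<longlonglongrightarrow> (\<integral>\<omega>. discounted_gain r \<alpha> (X x) (\<tau>D x) \<omega> \<partial>M) \<and>
         (\<lambda>k. \<integral>\<omega>. enn2real (running_cost r c (X x) (s k) \<omega>) \<partial>M)
           \<longlonglongrightarrow> (\<integral>\<omega>. enn2real (running_cost r c (X x) (\<tau>D x) \<omega>) \<partial>M) \<and>
         (\<lambda>k. \<integral>\<omega>. signed_discounted_integral r (A_pos x) (A_neg x) (s k) \<omega> \<partial>M)
           \<longlonglongrightarrow> (\<integral>\<omega>. signed_discounted_integral r (A_pos x) (A_neg x) (\<tau>D x) \<omega> \<partial>M)"
  shows "\<forall>x1\<ge>0. z x1 \<in> closure C \<longrightarrow>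
           (R \<longlongrightarrow> 0) (at (z x1) within C) \<and>
           (\<forall>\<kappa>>0. (R \<longlongrightarrow> 0) (at (z x1) within nontangential_region \<kappa> C (z x1)))"
proof -
  interpret reflected_stopping M F W \<mu> \<sigma> r \<alpha> c X L l by (fact setting)
  have R_eq: "R x = G \<alpha> x - V x" if x: "x \<in> quadrant" for x
  proof -
    \<comment> \<open>Here \<open>t\<close> stands for a whole random time, so that the same three
      expectations can be evaluated at \<open>s k\<close> and at the limit
      \<open>\<tau>D x\<close>.\<close>
    let ?g = "\<lambda>t. \<integral>\<omega>. discounted_gain r \<alpha> (X x) t \<omega> \<partial>M"
    let ?h = "\<lambda>t. \<integral>\<omega>. enn2real (running_cost r c (X x) t \<omega>) \<partial>M"
    let ?a = "\<lambda>t. \<integral>\<omega>. signed_discounted_integral r (A_pos x) (A_neg x) t \<omega> \<partial>M"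
    obtain N :: "real \<Rightarrow> 'a \<Rightarrow> real" and s :: "nat \<Rightarrow> 'a \<Rightarrow> ennreal" where
      "local_martingale M F N"
      and identity: "\<forall>k. AE \<omega> in M. discounted_gain r \<alpha> (X x) (s k) \<omega> =
              G \<alpha> x + enn2real (running_cost r c (X x) (s k) \<omega>)
              - signed_discounted_integral r (A_pos x) (A_neg x) (s k) \<omega>
              + N (enn2real (s k \<omega>)) \<omega>"
      and N: "\<forall>k. integrable M (\<lambda>\<omega>. N (enn2real (s k \<omega>)) \<omega>) \<and>
              (\<integral>\<omega>. N (enn2real (s k \<omega>)) \<omega> \<partial>M) = 0"
      and int_s: "\<forall>k. integrable M (discounted_gain r \<alpha> (X x) (s k)) \<and>
              integrable M (\<lambda>\<omega>. enn2real (running_cost r c (X x) (s k) \<omega>)) \<and>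
              integrable M (signed_discounted_integral r (A_pos x) (A_neg x) (s k))"
      and int_\<tau>: "integrable M (discounted_gain r \<alpha> (X x) (\<tau>D x))"
        "integrable M (\<lambda>\<omega>. enn2real (running_cost r c (X x) (\<tau>D x) \<omega>))"
      and lims: "(\<lambda>k. ?g (s k)) \<longlonglongrightarrow> ?g (\<tau>D x)" "(\<lambda>k. ?h (s k)) \<longlonglongrightarrow> ?h (\<tau>D x)"
        "(\<lambda>k. ?a (s k)) \<longlonglongrightarrow> ?a (\<tau>D x)"
      using bspec[OF ito_tanaka x] by (elim exE conjE) (rule that; assumption)
    have "?g (s k) = G \<alpha> x + ?h (s k) - ?a (s k)" for k
    proof -
      have "?g (s k) = (\<integral>\<omega>. G \<alpha> x + enn2real (running_cost r c (X x) (s k) \<omega>)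
              - signed_discounted_integral r (A_pos x) (A_neg x) (s k) \<omega>
              + N (enn2real (s k \<omega>)) \<omega> \<partial>M)"
        \<comment> \<open>The identity holds only almost surely, so the congruence rule also asks
          for measurability of both sides; it comes from the integrability of each term.\<close>
        by (rule integral_cong_AE)
          (use identity N int_s in
            \<open>auto intro!: borel_measurable_add borel_measurable_diff borel_measurable_integrable\<close>)
      also have "\<dots> = G \<alpha> x + ?h (s k) - ?a (s k)"
        \<comment> \<open>The martingale term has mean zero, and the constant
          \<open>G \<alpha> x\<close> integrates to itself because the total mass is 1.\<close>
        using N int_s by (simp add: prob_space)
      finally show ?thesis .
    qed
    \<comment> \<open>The left side tends to \<open>?g (\<tau>D x)\<close>, the right side to the
      same combination at \<open>\<tau>D x\<close>; uniqueness of limits carries the identity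
      over.\<close>
    moreover have "(\<lambda>k. G \<alpha> x + ?h (s k) - ?a (s k)) \<longlonglongrightarrow> G \<alpha> x + ?h (\<tau>D x) - ?a (\<tau>D x)"
      by (intro tendsto_intros lims)
    ultimately have "?g (\<tau>D x) = G \<alpha> x + ?h (\<tau>D x) - ?a (\<tau>D x)"
      using lims(1) LIMSEQ_unique by simp
    moreover have "R x = ?a (\<tau>D x)"
      by (simp add: R_def killed_resolvent_def tauD_def)
    moreover have "V x = ?g (\<tau>D x) - ?h (\<tau>D x)"
    proof -
      \<comment> \<open>\<open>V\<close> is the supremum pushed through
        \<open>real_of_ereal\<close>, which sends infinite values to 0. Optimality identifies the
        supremum with a real expected payoff, so the conversion is faithful here. Integrability at
        \<open>\<tau>D x\<close> then splits this payoff into gain minus cost.\<close>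
      have "V x = expected_payoff M r \<alpha> c (X x) (\<tau>D x)"
        using bspec[OF optimal x]
        by (metis V_def value_function_def optimal_stopping_time_def real_of_ereal.simps(1))
      then show ?thesis
        using int_\<tau> by (simp add: expected_payoff_def)
    qed
    ultimately show ?thesis by simp
  qed
  have gap_continuous: "continuous_on quadrant (\<lambda>x. G \<alpha> x - V x)"
    by (intro continuous_intros continuous_on_G V_continuous)
  have C_sub: "C \<subseteq> quadrant"
    by (auto simp: C_def)
  have lim_C: "(R \<longlongrightarrow> 0) (at (z x1) within C)" if x1: "0 \<le> x1" for x1
  proof -
    let ?gap = "\<lambda>t. G \<alpha> (vector [x1, t]) - V (vector [x1, t])"
    have "continuous_on {0..} ?gap"
      by (rule continuous_on_compose2[OF gap_continuous continuous_on_vector_2])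
        (use x1 in \<open>auto simp: vector_2_in_quadrant_iff\<close>)
    moreover have "\<exists>t\<ge>0. ?gap t = 0"
      using V_minus_G_vanishes x1 by force
    \<comment> \<open>For nonnegative \<open>x1\<close> and \<open>t\<close> the point lies in the
      quadrant, so its membership in \<open>D\<close> amounts to a vanishing gap.\<close>
    moreover have "b x1 = Inf {t. 0 \<le> t \<and> ?gap t = 0}"
      unfolding b_def using x1
      by (intro arg_cong[where f = Inf]) (auto simp: D_def vector_2_in_quadrant_iff)
    ultimately have b: "0 \<le> b x1" "?gap (b x1) = 0"
      using Inf_zero_set_attained[of ?gap] by simp_all
    have z: "z x1 \<in> quadrant" "G \<alpha> (z x1) - V (z x1) = 0"
      using b x1 by (simp_all add: z_def vector_2_in_quadrant_iff)
    \<comment> \<open>Continuity within the quadrant gives the value of the gap at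
      \<open>z x1\<close> as the limit, and that value is 0.\<close>
    have "((\<lambda>x. G \<alpha> x - V x) \<longlongrightarrow> 0) (at (z x1) within quadrant)"
      using gap_continuous z unfolding continuous_on_def by metis
    then have "((\<lambda>x. G \<alpha> x - V x) \<longlongrightarrow> 0) (at (z x1) within C)"
      using C_sub by (rule tendsto_within_subset)
    then show ?thesis
      \<comment> \<open>\<open>R\<close> and the gap agree on all of \<open>C\<close>, so any
        positive radius would do.\<close>
      by (rule Lim_transform_within[where d = 1]) (use R_eq C_sub in auto)
  qed
  \<comment> \<open>Inclusion in \<open>C\<close> is enough: the limit within \<open>C\<close>
    passes to every subset, whatever the aperture.\<close>
  moreover have "nontangential_region \<kappa> C y \<subseteq> C" for \<kappa> y
    by (auto simp: nontangential_region_def)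
  ultimately show ?thesis
    by (meson tendsto_within_subset)
qed

end
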